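(* Let $Q$ be a Noetherian commutative monoid, and let $\sim$ be a congruence on a $Q$-module $T$. The common refinement (intersection), over all prime ideals $P\subset Q$ and all key $\sim$-witnesses $w$ for $P$, of the congruences $\sim_w^P$ on $T/{\sim}$ cogenerated by $w$ along $P$ identifies only the nil elements of $T/{\sim}$: two distinct elements of $T/{\sim}$ are identified by this common refinement if and only if both are nil.
   Context: $Q$ is a commutative monoid, written additively with identity $0$; Noetherian means equivalently that $Q$ is finitely generated. A $Q$-module is a set $T$ with a left action of $Q$ such that $0\cdot t=t$ and $(q+q')\cdot t=q\cdot(q'\cdot t)$. For $t\in T$, $\langle t\rangle=Q\cdot t$. An element $\infty\in T$ is nil if $Q\cdot\infty=\{\infty\}$. A congruence on $T$ is an equivalence relation $\sim$ with $t\sim t'\Rightarrow q\cdot t\sim q\cdot t'$ for all $q\in Q$; then $T/{\sim}$ is a $Q$-module. The kernel of a module homomorphism $\phi$ is the congruence identifying $t,t'$ whenever $\phi(t)=\phi(t')$. Green's preorder on a module sets $t\preceq t'$ whenever $\langle t\rangle\supset\langle t'\rangle$. An ideal of $Q$ is a (possibly empty) subset $I$ with $Q+I\subset I$; an ideal $P$ is prime if $Q\setminus P$ is a submonoid. For $P$ prime with $F=Q\setminus P$, the localization $T_P$ of a $Q$-module $T$ is $T\times F$ modulo $(t,f)\sim(t',f')$ iff $w\cdot f'\cdot t=w\cdot f\cdot t'$ for some $w\in F$; $Q_P$ is a monoid and $T_P$ is a $Q_P$-module. Write $\overline T=T/{\sim}$; for $t$ in $T$ (or in $\overline T$), $\bar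 t$ denotes its image in $\overline T_P$. For $p\in P$ let $\phi_p:\overline T_P\to\overline T_P$ be the action of $p$. An element $w$ is exclusively maximal in a set $A\subset\overline T_P$ if $\bar w$ is the unique maximal element of $A$ under Green's preorder. An element $w\in T$ with non-nil image in $\overline T_P$ is a key $\sim$-witness for $P$ if the class of $\bar w$ under $\bigcap_{p\in P}\ker(\phi_p)$ is not a singleton and $\bar w$ is not exclusively maximal in this class. For such $P$ and $w$, the order ideal $\overline T_{\preceq w}^P$ cogenerated by $w$ at $P$ is the set of $a\in\overline T$ with $\bar a\preceq\bar w$ in $\overline T_P$. The (coprincipal) congruence $\sim_w^P$ cogenerated by $w$ along $P$ is the equivalence relation on $\overline T$ that sets all elements outside $\overline T_{\preceq w}^P$ equivalent to one another, and sets $a\sim_w^P b$ whenever $\bar a$ and $\bar b$ differ by a unit of $Q_P$ in $\overline T_P$ (i.e. $\bar a=u\cdot\bar b$ for some unit $u\in Q_P$) and $q\cdot\bar a=q\cdot\bar b=\bar w$ for some $q\in Q_P$. *)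

theory Defs
  imports "HOL-Algebra.Group"
begin

text \<open>
  The monoid \<open>Q\<close> is a commutative monoid in the sense of HOL-Algebra, hence written
  multiplicatively: \<open>\<otimes>\<close> and \<open>\<one>\<close> are the sum and the identity \<open>0\<close> of the additive notation.
\<close>

section \<open>Monoid modules\<close>

record ('q, 't) mset = "'t partial_object" +
  act :: "'q \<Rightarrow> 't \<Rightarrow> 't"

locale monoid_module = comm_monoid Q for Q (structure) +
  fixes T :: "('q, 't) mset"
  assumes act_closed: "\<lbrakk>q \<in> carrier Q; t \<in> carrier T\<rbrakk> \<Longrightarrow> act T q t \<in> carrier T"
    and act_one: "t \<in> carrier T \<Longrightarrow> act T \<one> t = t"
    and act_mult: "\<lbrakk>q \<in> carrier Q; q' \<in> carrier Q; t \<in> carrier T\<rbrakk>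
      \<Longrightarrow> act T (q \<otimes> q') t = act T q (act T q' t)"

text \<open>For commutative monoids, Noetherian is equivalent to finitely generated.\<close>

definition noetherian_monoid :: "('q, 'm) monoid_scheme \<Rightarrow> bool" where
  "noetherian_monoid Q \<longleftrightarrow>
     (\<exists>A. finite A \<and> A \<subseteq> carrier Q \<and> (\<forall>H. submonoid H Q \<and> A \<subseteq> H \<longrightarrow> H = carrier Q))"

definition orbit_of :: "('q, 'm) monoid_scheme \<Rightarrow> ('q, 't) mset \<Rightarrow> 't \<Rightarrow> 't set" where
  "orbit_of Q T t = {act T q t | q. q \<in> carrier Q}"

definition nil :: "('q, 'm) monoid_scheme \<Rightarrow> ('q, 't) mset \<Rightarrow> 't \<Rightarrow> bool" where
  "nil Q T x \<longleftrightarrow> x \<in> carrier T \<and> orbit_of Q T x = {x}"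

definition green_le :: "('q, 'm) monoid_scheme \<Rightarrow> ('q, 't) mset \<Rightarrow> 't \<Rightarrow> 't \<Rightarrow> bool" where
  "green_le Q T t t' \<longleftrightarrow> orbit_of Q T t \<supseteq> orbit_of Q T t'"

definition module_congruence ::
  "('q, 'm) monoid_scheme \<Rightarrow> ('q, 't) mset \<Rightarrow> ('t \<times> 't) set \<Rightarrow> bool" where
  "module_congruence Q T r \<longleftrightarrow> equiv (carrier T) r \<and>
     (\<forall>(t, t') \<in> r. \<forall>q \<in> carrier Q. (act T q t, act T q t') \<in> r)"

definition quot_module :: "('q, 't) mset \<Rightarrow> ('t \<times> 't) set \<Rightarrow> ('q, 't set) mset" where
  "quot_module T r =
     \<lparr>carrier = carrier T // r, act = (\<lambda>q X. \<Union>t\<in>X. r `` {act T q t})\<rparr>"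

lemma quot_module_act:
  assumes M: "monoid_module Q T" and r: "module_congruence Q T r"
    and q: "q \<in> carrier Q" and t: "t \<in> carrier T"
  shows "act (quot_module T r) q (r `` {t}) = r `` {act T q t}"
proof -
  have e: "equiv (carrier T) r" using r by (simp add: module_congruence_def)
  have "r `` {act T q x} = r `` {act T q t}" if "x \<in> r `` {t}" for x
  proof -
    have "(act T q t, act T q x) \<in> r"
      using r q that unfolding module_congruence_def by fast
    then show ?thesis using equiv_class_eq[OF e] by metis
  qed
  moreover have "t \<in> r `` {t}" using equiv_class_self[OF e t] .
  ultimately have "(\<Union>x\<in>r `` {t}. r `` {act T q x}) = r `` {act T q t}"
    by (intro UN_constant_eq ballI)
  then show ?thesis by (simp add: quot_module_def)
qed

lemma monoid_module_quot_module:
  fixes Q (structure)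
  assumes M: "monoid_module Q T" and r: "module_congruence Q T r"
  shows "monoid_module Q (quot_module T r)"
proof -
  interpret monoid_module Q T by fact
  have c: "carrier (quot_module T r) = carrier T // r" by (simp add: quot_module_def)
  show ?thesis
  proof (unfold_locales, unfold c)
    fix q X assume q: "q \<in> carrier Q" and "X \<in> carrier T // r"
    then obtain t where t: "t \<in> carrier T" "X = r `` {t}" by (auto elim: quotientE)
    show "act (quot_module T r) q X \<in> carrier T // r"
      using t q by (simp add: quot_module_act[OF M r] quotientI act_closed)
  next
    fix X assume "X \<in> carrier T // r"
    then obtain t where t: "t \<in> carrier T" "X = r `` {t}" by (auto elim: quotientE)
    then show "act (quot_module T r) \<one> X = X"
      by (simp add: quot_module_act[OF M r] act_one)
  next
    fix q q' X assume q: "q \<in> carrier Q" "q' \<in> carrier Q" and "X \<in> carrier T // r"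
    then obtain t where t: "t \<in> carrier T" "X = r `` {t}" by (auto elim: quotientE)
    then show "act (quot_module T r) (q \<otimes> q') X
        = act (quot_module T r) q (act (quot_module T r) q' X)"
      using q by (simp add: quot_module_act[OF M r] act_mult act_closed)
  qed
qed

lemma green_le_iff:
  fixes Q (structure)
  assumes "monoid_module Q T" "t \<in> carrier T" "t' \<in> carrier T"
  shows "green_le Q T t t' \<longleftrightarrow> (\<exists>q \<in> carrier Q. act T q t = t')"
proof -
  interpret monoid_module Q T by fact
  have "t' \<in> orbit_of Q T t'"
    unfolding orbit_of_def using act_one[OF assms(3)] by (metis (mono_tags) mem_Collect_eq one_closed)
  moreover have "orbit_of Q T (act T q t) \<subseteq> orbit_of Q T t" if "q \<in> carrier Q" for q
    unfolding orbit_of_def using act_mult[OF _ that assms(2), symmetric] that by auto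
  ultimately show ?thesis unfolding green_le_def by (auto simp: orbit_of_def)
qed

lemma unit_cancel:
  fixes Q (structure)
  assumes "monoid_module Q T"
    and c: "a \<in> carrier T" "b \<in> carrier T" "u \<in> Units Q" "q \<in> carrier Q" "s \<in> carrier Q"
    and h: "a = act T u b" "act T q a = w" "act T q b = w" "act T s a = w"
  shows "act T s b = w"
proof -
  interpret monoid_module Q T by fact
  have u: "u \<in> carrier Q" "inv u \<in> carrier Q" "inv u \<otimes> u = \<one>" using c by auto
  have w: "w \<in> carrier T" using act_closed c h by auto
  have "act T u w = act T q a"
    using c u by (simp add: h(1) h(3)[symmetric] act_mult[symmetric] m_comm)
  then have uw: "act T u w = w" using h by simp
  have ui: "act T (inv u) (act T u x) = x" if "x \<in> carrier T" for x
    using that u by (simp add: act_mult[symmetric] act_one)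
  have "act T s a = act T u (act T s b)"
    using c u by (simp add: h(1) act_mult[symmetric] m_comm)
  then have "act T u (act T s b) = act T u w" using h uw by simp
  then show ?thesis using ui act_closed c w by metis
qed

section \<open>Localization\<close>

definition monoid_ideal :: "('q, 'm) monoid_scheme \<Rightarrow> 'q set \<Rightarrow> bool" where
  "monoid_ideal Q I \<longleftrightarrow> I \<subseteq> carrier Q \<and> (\<forall>q \<in> carrier Q. \<forall>i \<in> I. q \<otimes>\<^bsub>Q\<^esub> i \<in> I)"

definition prime_monoid_ideal :: "('q, 'm) monoid_scheme \<Rightarrow> 'q set \<Rightarrow> bool" where
  "prime_monoid_ideal Q P \<longleftrightarrow> monoid_ideal Q P \<and> submonoid (carrier Q - P) Q"

definition loc_rel ::
  "('q, 'm) monoid_scheme \<Rightarrow> 'q set \<Rightarrow> ('q, 't) mset \<Rightarrow> (('t \<times> 'q) \<times> ('t \<times> 'q)) set" where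
  "loc_rel Q P T = {((t, f), (t', f')).
     t \<in> carrier T \<and> t' \<in> carrier T \<and> f \<in> carrier Q - P \<and> f' \<in> carrier Q - P \<and>
     (\<exists>w \<in> carrier Q - P. act T w (act T f' t) = act T w (act T f t'))}"

definition frac ::
  "('q, 'm) monoid_scheme \<Rightarrow> 'q set \<Rightarrow> ('q, 't) mset \<Rightarrow> 't \<Rightarrow> 'q \<Rightarrow> ('t \<times> 'q) set" where
  "frac Q P T t f = loc_rel Q P T `` {(t, f)}"

definition loc_map ::
  "('q, 'm) monoid_scheme \<Rightarrow> 'q set \<Rightarrow> ('q, 't) mset \<Rightarrow> 't \<Rightarrow> ('t \<times> 'q) set" where
  "loc_map Q P T t = frac Q P T t \<one>\<^bsub>Q\<^esub>"

definition regular_module :: "('q, 'm) monoid_scheme \<Rightarrow> ('q, 'q) mset" where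
  "regular_module Q = \<lparr>carrier = carrier Q, act = (\<lambda>q x. q \<otimes>\<^bsub>Q\<^esub> x)\<rparr>"

definition loc_monoid :: "('q, 'm) monoid_scheme \<Rightarrow> 'q set \<Rightarrow> ('q \<times> 'q) set monoid" where
  "loc_monoid Q P =
     \<lparr>carrier = (carrier Q \<times> (carrier Q - P)) // loc_rel Q P (regular_module Q),
      mult = (\<lambda>X Y. \<Union>(q, f)\<in>X. \<Union>(q', f')\<in>Y.
        frac Q P (regular_module Q) (q \<otimes>\<^bsub>Q\<^esub> q') (f \<otimes>\<^bsub>Q\<^esub> f')),
      one = frac Q P (regular_module Q) \<one>\<^bsub>Q\<^esub> \<one>\<^bsub>Q\<^esub>\<rparr>"

text \<open>The localization \<open>T\<^sub>P\<close> as a module over \<open>Q\<^sub>P\<close>.\<close>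

definition loc_module ::
  "('q, 'm) monoid_scheme \<Rightarrow> 'q set \<Rightarrow> ('q, 't) mset \<Rightarrow> (('q \<times> 'q) set, ('t \<times> 'q) set) mset" where
  "loc_module Q P T =
     \<lparr>carrier = (carrier T \<times> (carrier Q - P)) // loc_rel Q P T,
      act = (\<lambda>X Y. \<Union>(q, f)\<in>X. \<Union>(t, f')\<in>Y. frac Q P T (act T q t) (f \<otimes>\<^bsub>Q\<^esub> f'))\<rparr>"

locale localized_module = monoid_module Q T for Q (structure) and T :: "('q, 't) mset" +
  fixes P :: "'q set"
  assumes prime: "prime_monoid_ideal Q P"
begin

lemma denom: "f \<in> carrier Q - P \<Longrightarrow> g \<in> carrier Q - P \<Longrightarrow> f \<otimes> g \<in> carrier Q - P"
    "\<one> \<in> carrier Q - P" "f \<in> carrier Q - P \<Longrightarrow> f \<in> carrier Q"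
proof -
  interpret S: submonoid "carrier Q - P" Q
    using prime by (simp add: prime_monoid_ideal_def)
  show "f \<in> carrier Q - P \<Longrightarrow> g \<in> carrier Q - P \<Longrightarrow> f \<otimes> g \<in> carrier Q - P"
    by (rule S.m_closed)
  show "\<one> \<in> carrier Q - P" by (rule S.one_closed)
  show "f \<in> carrier Q - P \<Longrightarrow> f \<in> carrier Q" by simp
qed

lemma loc_rel_iff:
  "((t, f), (t', f')) \<in> loc_rel Q P T \<longleftrightarrow>
     t \<in> carrier T \<and> t' \<in> carrier T \<and> f \<in> carrier Q - P \<and> f' \<in> carrier Q - P \<and>
     (\<exists>w \<in> carrier Q - P. act T (w \<otimes> f') t = act T (w \<otimes> f) t')"
proof -
  have "(\<exists>w \<in> carrier Q - P. act T w (act T f' t) = act T w (act T f t')) \<longleftrightarrow>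
      (\<exists>w \<in> carrier Q - P. act T (w \<otimes> f') t = act T (w \<otimes> f) t')"
    if "t \<in> carrier T" "t' \<in> carrier T" "f \<in> carrier Q - P" "f' \<in> carrier Q - P"
    using that by (intro bex_cong refl) (simp add: act_mult)
  then show ?thesis unfolding loc_rel_def by blast
qed

lemma equiv_loc_rel: "equiv (carrier T \<times> (carrier Q - P)) (loc_rel Q P T)"
proof (rule equivI)
  show "loc_rel Q P T \<subseteq> (carrier T \<times> (carrier Q - P)) \<times> carrier T \<times> (carrier Q - P)"
    by (auto simp: loc_rel_def)
  show "refl_on (carrier T \<times> (carrier Q - P)) (loc_rel Q P T)"
    using denom(2) by (auto simp: refl_on_def loc_rel_def)
  show "sym (loc_rel Q P T)"
    by (rule symI) (clarsimp simp: loc_rel_def, metis DiffI)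
  show "trans (loc_rel Q P T)"
  proof (rule transI, clarify)
    fix t f t' f' t'' f''
    assume 1: "((t, f), (t', f')) \<in> loc_rel Q P T" and 2: "((t', f'), (t'', f'')) \<in> loc_rel Q P T"
    obtain w where w: "w \<in> carrier Q - P" "act T (w \<otimes> f') t = act T (w \<otimes> f) t'"
      using 1 loc_rel_iff by blast
    obtain v where v: "v \<in> carrier Q - P" "act T (v \<otimes> f'') t' = act T (v \<otimes> f') t''"
      using 2 loc_rel_iff by blast
    have m: "t \<in> carrier T" "t' \<in> carrier T" "t'' \<in> carrier T"
      "f \<in> carrier Q - P" "f' \<in> carrier Q - P" "f'' \<in> carrier Q - P"
      using 1 2 loc_rel_iff by blast+
    note c = w(1)[THEN denom(3)] v(1)[THEN denom(3)] m(4-6)[THEN denom(3)]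
    have "act T ((w \<otimes> v \<otimes> f') \<otimes> f'') t = act T (v \<otimes> f'') (act T (w \<otimes> f') t)"
      using c m by (simp add: act_mult[symmetric] m_ac)
    also have "\<dots> = act T (w \<otimes> f) (act T (v \<otimes> f'') t')"
      using c m w by (simp add: act_mult[symmetric] m_ac)
    also have "\<dots> = act T ((w \<otimes> v \<otimes> f') \<otimes> f) t''"
      using c m v by (simp add: act_mult[symmetric] m_ac)
    finally show "((t, f), (t'', f'')) \<in> loc_rel Q P T"
      unfolding loc_rel_iff using m w(1) v(1) denom(1) by blast
  qed
qed

lemma frac_eq_iff:
  assumes "t \<in> carrier T" "t' \<in> carrier T" "f \<in> carrier Q - P" "f' \<in> carrier Q - P"
  shows "frac Q P T t f = frac Q P T t' f' \<longleftrightarrow>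
    (\<exists>w \<in> carrier Q - P. act T (w \<otimes> f') t = act T (w \<otimes> f) t')"
  unfolding frac_def using eq_equiv_class_iff[OF equiv_loc_rel, of "(t, f)" "(t', f')"] assms
  by (simp add: loc_rel_iff)

lemma carrier_loc_moduleE:
  assumes "X \<in> carrier (loc_module Q P T)"
  obtains t f where "t \<in> carrier T" "f \<in> carrier Q - P" "X = frac Q P T t f"
  using assms unfolding loc_module_def frac_def by (auto elim!: quotientE)

lemma frac_in_loc_module:
  "t \<in> carrier T \<Longrightarrow> f \<in> carrier Q - P \<Longrightarrow> frac Q P T t f \<in> carrier (loc_module Q P T)"
  unfolding loc_module_def frac_def by (auto intro: quotientI)

end

lemma regular_localized_module:
  fixes Q (structure)
  assumes "comm_monoid Q" "prime_monoid_ideal Q P"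
  shows "localized_module Q (regular_module Q) P"
proof -
  interpret comm_monoid Q by fact
  show ?thesis
    by unfold_locales (auto simp: regular_module_def m_assoc assms)
qed

lemma UN2_const:
  assumes "a \<in> A" "b \<in> B" "\<And>x y. x \<in> A \<Longrightarrow> y \<in> B \<Longrightarrow> h x y = K"
  shows "(\<Union>x\<in>A. \<Union>y\<in>B. h x y) = K"
  using assms by blast

lemma loc_act_frac:
  fixes Q (structure)
  assumes M: "localized_module Q T P"
    and m: "q \<in> carrier Q" "f \<in> carrier Q - P" "t \<in> carrier T" "g \<in> carrier Q - P"
  shows "act (loc_module Q P T) (frac Q P (regular_module Q) q f) (frac Q P T t g)
    = frac Q P T (act T q t) (f \<otimes> g)"
proof -
  interpret localized_module Q T P by fact
  interpret R: localized_module Q "regular_module Q" P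
    by (rule regular_localized_module[OF comm_monoid_axioms prime])
  have indep: "frac Q P T (act T q' t') (f' \<otimes> g') = frac Q P T (act T q t) (f \<otimes> g)"
    if 1: "(q', f') \<in> frac Q P (regular_module Q) q f" and 2: "(t', g') \<in> frac Q P T t g" for q' f' t' g'
  proof -
    note d = 1[unfolded frac_def Image_singleton_iff R.loc_rel_iff]
      2[unfolded frac_def Image_singleton_iff loc_rel_iff]
    obtain w where w: "w \<in> carrier Q - P" "w \<otimes> f' \<otimes> q = w \<otimes> f \<otimes> q'"
      using d(1) unfolding regular_module_def by auto
    obtain v where v: "v \<in> carrier Q - P" "act T (v \<otimes> g') t = act T (v \<otimes> g) t'"
      using d(2) by blast
    have n: "q' \<in> carrier Q" "f' \<in> carrier Q - P" "t' \<in> carrier T" "g' \<in> carrier Q - P"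
      using d by (simp_all add: regular_module_def)
    note c = w(1)[THEN denom(3)] v(1)[THEN denom(3)] m(2,4)[THEN denom(3)] n(2,4)[THEN denom(3)] m(1,3) n(1,3)
    have "act T ((w \<otimes> v) \<otimes> (f \<otimes> g)) (act T q' t') = act T (w \<otimes> f \<otimes> q') (act T (v \<otimes> g) t')"
      using c by (simp add: act_mult[symmetric] m_ac)
    also have "\<dots> = act T (w \<otimes> f' \<otimes> q) (act T (v \<otimes> g') t)"
      by (simp only: w(2) v(2))
    also have "\<dots> = act T ((w \<otimes> v) \<otimes> (f' \<otimes> g')) (act T q t)"
      using c by (simp add: act_mult[symmetric] m_ac)
    finally show ?thesis
      using frac_eq_iff[of "act T q' t'" "act T q t" "f' \<otimes> g'" "f \<otimes> g"]
        act_closed[OF n(1,3)] act_closed[OF m(1,3)] denom(1)[OF n(2,4)] denom(1)[OF m(2,4)] denom(1)[OF w(1) v(1)]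
      by blast
  qed
  have self: "(q, f) \<in> frac Q P (regular_module Q) q f" "(t, g) \<in> frac Q P T t g"
    unfolding frac_def using equiv_class_self[OF equiv_loc_rel] equiv_class_self[OF R.equiv_loc_rel] m
    by (simp_all add: regular_module_def)
  have "(\<Union>x\<in>frac Q P (regular_module Q) q f. \<Union>y\<in>frac Q P T t g.
      frac Q P T (act T (fst x) (fst y)) (snd x \<otimes> snd y)) = frac Q P T (act T q t) (f \<otimes> g)"
    by (rule UN2_const[OF self], rule indep) (simp_all only: prod.collapse)
  then show ?thesis by (simp add: loc_module_def case_prod_beta)
qed

lemma loc_monoid_regular:
  "carrier (loc_monoid Q P) = carrier (loc_module Q P (regular_module Q))"
  "mult (loc_monoid Q P) = act (loc_module Q P (regular_module Q))"
  by (simp_all add: loc_monoid_def loc_module_def regular_module_def)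

lemma comm_monoid_loc_monoid:
  fixes Q (structure)
  assumes "comm_monoid Q" "prime_monoid_ideal Q P"
  shows "comm_monoid (loc_monoid Q P)"
proof -
  interpret localized_module Q "regular_module Q" P
    by (rule regular_localized_module[OF assms])
  note L = loc_act_frac[OF localized_module_axioms]
  have S: "act (regular_module Q) = mult Q" "carrier (regular_module Q) = carrier Q"
    by (auto simp: regular_module_def)
  have O: "\<one>\<^bsub>loc_monoid Q P\<^esub> = frac Q P (regular_module Q) \<one> \<one>"
    by (simp add: loc_monoid_def)
  show ?thesis
  proof (rule comm_monoidI, unfold loc_monoid_regular O)
    fix x y assume "x \<in> carrier (loc_module Q P (regular_module Q))"
      "y \<in> carrier (loc_module Q P (regular_module Q))"
    then show "act (loc_module Q P (regular_module Q)) x y \<in> carrier (loc_module Q P (regular_module Q))"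
      "act (loc_module Q P (regular_module Q)) x y = act (loc_module Q P (regular_module Q)) y x"
      by (elim carrier_loc_moduleE; use denom(1) in \<open>simp add: L S frac_in_loc_module m_ac\<close>)+
  next
    show "frac Q P (regular_module Q) \<one> \<one> \<in> carrier (loc_module Q P (regular_module Q))"
      using denom(2) by (simp add: frac_in_loc_module S)
  next
    fix x y z assume "x \<in> carrier (loc_module Q P (regular_module Q))"
      "y \<in> carrier (loc_module Q P (regular_module Q))"
      "z \<in> carrier (loc_module Q P (regular_module Q))"
    then show "act (loc_module Q P (regular_module Q)) (act (loc_module Q P (regular_module Q)) x y) z
      = act (loc_module Q P (regular_module Q)) x (act (loc_module Q P (regular_module Q)) y z)"
      by (elim carrier_loc_moduleE; use denom(1) in \<open>simp add: L S m_ac\<close>)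
  next
    fix x assume "x \<in> carrier (loc_module Q P (regular_module Q))"
    then show "act (loc_module Q P (regular_module Q)) (frac Q P (regular_module Q) \<one> \<one>) x = x"
      by (elim carrier_loc_moduleE; use denom(2) in \<open>simp add: L S\<close>)
  qed
qed

lemma monoid_module_loc_module:
  fixes Q (structure)
  assumes "localized_module Q T P"
  shows "monoid_module (loc_monoid Q P) (loc_module Q P T)"
proof -
  interpret localized_module Q T P by fact
  interpret R: localized_module Q "regular_module Q" P
    by (rule regular_localized_module[OF comm_monoid_axioms prime])
  interpret LQ: comm_monoid "loc_monoid Q P"
    by (rule comm_monoid_loc_monoid[OF comm_monoid_axioms prime])
  note L = loc_act_frac[OF localized_module_axioms] loc_act_frac[OF R.localized_module_axioms]
  have S: "act (regular_module Q) = mult Q" "carrier (regular_module Q) = carrier Q"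
    by (auto simp: regular_module_def)
  have O: "\<one>\<^bsub>loc_monoid Q P\<^esub> = frac Q P (regular_module Q) \<one> \<one>"
    by (simp add: loc_monoid_def)
  show ?thesis
  proof (unfold_locales, unfold loc_monoid_regular O)
    fix x y assume "x \<in> carrier (loc_module Q P (regular_module Q))" "y \<in> carrier (loc_module Q P T)"
    then show "act (loc_module Q P T) x y \<in> carrier (loc_module Q P T)"
      by (elim carrier_loc_moduleE R.carrier_loc_moduleE)
        (use denom(1) in \<open>simp add: L S frac_in_loc_module act_closed\<close>)
  next
    fix y assume "y \<in> carrier (loc_module Q P T)"
    then show "act (loc_module Q P T) (frac Q P (regular_module Q) \<one> \<one>) y = y"
      by (elim carrier_loc_moduleE) (use denom(2) in \<open>simp add: L S act_one\<close>)
  next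
    fix x x' y assume "x \<in> carrier (loc_module Q P (regular_module Q))"
      "x' \<in> carrier (loc_module Q P (regular_module Q))" "y \<in> carrier (loc_module Q P T)"
    then show "act (loc_module Q P T) (act (loc_module Q P (regular_module Q)) x x') y
      = act (loc_module Q P T) x (act (loc_module Q P T) x' y)"
      by (elim carrier_loc_moduleE R.carrier_loc_moduleE)
        (use denom(1) in \<open>simp add: L S m_assoc act_mult act_closed\<close>)
  qed
qed

section \<open>Key witnesses and cogenerated congruences\<close>

definition action_map ::
  "('q, 'm) monoid_scheme \<Rightarrow> 'q set \<Rightarrow> ('q, 't) mset \<Rightarrow> 'q \<Rightarrow> ('t \<times> 'q) set \<Rightarrow> ('t \<times> 'q) set" where
  "action_map Q P T p = act (loc_module Q P T) (loc_map Q P (regular_module Q) p)"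

definition kernel_of :: "'a set \<Rightarrow> ('a \<Rightarrow> 'b) \<Rightarrow> ('a \<times> 'a) set" where
  "kernel_of A \<phi> = {(x, y). x \<in> A \<and> y \<in> A \<and> \<phi> x = \<phi> y}"

text \<open>The intersection over \<open>P = {}\<close> is the universal congruence on \<open>T\<^sub>P\<close>.\<close>

definition prime_kernel ::
  "('q, 'm) monoid_scheme \<Rightarrow> 'q set \<Rightarrow> ('q, 't) mset \<Rightarrow> (('t \<times> 'q) set \<times> ('t \<times> 'q) set) set" where
  "prime_kernel Q P T =
     (carrier (loc_module Q P T) \<times> carrier (loc_module Q P T)) \<inter>
     (\<Inter>p\<in>P. kernel_of (carrier (loc_module Q P T)) (action_map Q P T p))"

definition maximal_elements ::
  "('q, 'm) monoid_scheme \<Rightarrow> ('q, 't) mset \<Rightarrow> 't set \<Rightarrow> 't set" where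
  "maximal_elements Q T A =
     {m \<in> A. \<forall>x \<in> A. green_le Q T m x \<longrightarrow> green_le Q T x m}"

text \<open>
  Uniqueness is literal: a maximal element that is Green-equivalent to another
  element of \<open>A\<close> is not exclusively maximal.
\<close>

definition exclusively_maximal ::
  "('q, 'm) monoid_scheme \<Rightarrow> ('q, 't) mset \<Rightarrow> 't set \<Rightarrow> 't \<Rightarrow> bool" where
  "exclusively_maximal Q T A x \<longleftrightarrow> maximal_elements Q T A = {x}"

text \<open>The image in the localization of \<open>T/\<sim>\<close> at \<open>P\<close> of an element \<open>w\<close> of \<open>T\<close>.\<close>

definition bar ::
  "('q, 'm) monoid_scheme \<Rightarrow> ('q, 't) mset \<Rightarrow> ('t \<times> 't) set \<Rightarrow> 'q set \<Rightarrow> 't \<Rightarrow> ('t set \<times> 'q) set" where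
  "bar Q T r P w = loc_map Q P (quot_module T r) (r `` {w})"

definition key_witness ::
  "('q, 'm) monoid_scheme \<Rightarrow> ('q, 't) mset \<Rightarrow> ('t \<times> 't) set \<Rightarrow> 'q set \<Rightarrow> 't \<Rightarrow> bool" where
  "key_witness Q T r P w \<longleftrightarrow>
     w \<in> carrier T \<and>
     \<not> nil (loc_monoid Q P) (loc_module Q P (quot_module T r)) (bar Q T r P w) \<and>
     \<not> is_singleton (prime_kernel Q P (quot_module T r) `` {bar Q T r P w}) \<and>
     \<not> exclusively_maximal (loc_monoid Q P) (loc_module Q P (quot_module T r))
         (prime_kernel Q P (quot_module T r) `` {bar Q T r P w}) (bar Q T r P w)"

definition cogen_order_ideal ::
  "('q, 'm) monoid_scheme \<Rightarrow> ('q, 't) mset \<Rightarrow> ('t \<times> 't) set \<Rightarrow> 'q set \<Rightarrow> 't \<Rightarrow> 't set set" where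
  "cogen_order_ideal Q T r P w =
     {a \<in> carrier (quot_module T r).
        green_le (loc_monoid Q P) (loc_module Q P (quot_module T r))
          (loc_map Q P (quot_module T r) a) (bar Q T r P w)}"

text \<open>
  No closure operation is applied: the prescribed pairs already form a congruence on
  \<open>T/\<sim>\<close>, see \<open>module_congruence_cogen_congruence\<close>.
\<close>

definition cogen_congruence ::
  "('q, 'm) monoid_scheme \<Rightarrow> ('q, 't) mset \<Rightarrow> ('t \<times> 't) set \<Rightarrow> 'q set \<Rightarrow> 't \<Rightarrow> ('t set \<times> 't set) set" where
  "cogen_congruence Q T r P w =
     {(a, b). a \<in> carrier (quot_module T r) \<and> b \<in> carrier (quot_module T r) \<and>
        (a \<notin> cogen_order_ideal Q T r P w \<and> b \<notin> cogen_order_ideal Q T r P w \<or>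
         (\<exists>u \<in> Units (loc_monoid Q P).
            loc_map Q P (quot_module T r) a =
              act (loc_module Q P (quot_module T r)) u (loc_map Q P (quot_module T r) b)) \<and>
         (\<exists>q \<in> carrier (loc_monoid Q P).
            act (loc_module Q P (quot_module T r)) q (loc_map Q P (quot_module T r) a)
              = bar Q T r P w \<and>
            act (loc_module Q P (quot_module T r)) q (loc_map Q P (quot_module T r) b)
              = bar Q T r P w))}"

lemma module_congruence_cogen_congruence:
  fixes Q (structure)
  assumes M: "monoid_module Q T" and r: "module_congruence Q T r"
    and P: "prime_monoid_ideal Q P" and w: "w \<in> carrier T"
  shows "module_congruence Q (quot_module T r) (cogen_congruence Q T r P w)"
proof -
  define N where "N = quot_module T r"
  define K where "K = loc_monoid Q P"
  define L where "L = loc_module Q P N"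
  define l where "l = loc_map Q P N"
  define v where "v = bar Q T r P w"
  define i where "i = loc_map Q P (regular_module Q)"
  have NM: "monoid_module Q N" unfolding N_def by (rule monoid_module_quot_module[OF M r])
  interpret N: localized_module Q N P
    using NM P by (simp add: localized_module_def localized_module_axioms_def)
  interpret R: localized_module Q "regular_module Q" P
    by (rule regular_localized_module[OF N.comm_monoid_axioms P])
  have LM: "monoid_module K L"
    unfolding K_def L_def by (rule monoid_module_loc_module[OF N.localized_module_axioms])
  interpret L: monoid_module K L by (rule LM)
  have l: "l a \<in> carrier L" if "a \<in> carrier N" for a
    unfolding l_def L_def loc_map_def using that N.denom(2) by (rule N.frac_in_loc_module)
  have i: "i q \<in> carrier K" if "q \<in> carrier Q" for q
  proof -
    have "q \<in> carrier (regular_module Q)" using that by (simp add: regular_module_def)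
    then show ?thesis unfolding i_def K_def loc_map_def loc_monoid_regular
      using N.denom(2) by (rule R.frac_in_loc_module)
  qed
  have li: "l (act N q a) = act L (i q) (l a)" if "q \<in> carrier Q" "a \<in> carrier N" for q a
    unfolding l_def L_def i_def loc_map_def
    using that loc_act_frac[OF N.localized_module_axioms] N.denom(2) by simp
  have v: "v \<in> carrier L"
    using l[of "r `` {w}"] w unfolding v_def bar_def l_def N_def by (simp add: quot_module_def quotientI)
  define I where "I = {a \<in> carrier N. \<exists>s \<in> carrier K. act L s (l a) = v}"
  have I: "cogen_order_ideal Q T r P w = I"
    unfolding cogen_order_ideal_def I_def using green_le_iff[OF LM l v]
    unfolding N_def K_def L_def l_def v_def by auto
  define E where "E a b \<longleftrightarrow> (\<exists>u \<in> Units K. l a = act L u (l b)) \<and>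
      (\<exists>q \<in> carrier K. act L q (l a) = v \<and> act L q (l b) = v)" for a b
  have C: "(a, b) \<in> cogen_congruence Q T r P w \<longleftrightarrow>
      a \<in> carrier N \<and> b \<in> carrier N \<and> (a \<notin> I \<and> b \<notin> I \<or> E a b)" for a b
    unfolding cogen_congruence_def I E_def unfolding N_def K_def L_def l_def v_def by simp
  have E_sym: "E b a" if h: "E a b" "a \<in> carrier N" "b \<in> carrier N" for a b
  proof -
    obtain u where u: "u \<in> Units K" "l a = act L u (l b)" using h(1) unfolding E_def by blast
    then have "l b = act L (inv\<^bsub>K\<^esub> u) (l a)"
      using l h by (simp add: L.act_mult[symmetric] L.act_one L.Units_closed)
    then show ?thesis using h u L.Units_inv_Units unfolding E_def by blast
  qed
  have E_cancel: "act L s (l b) = v"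
    if h: "E a b" "a \<in> carrier N" "b \<in> carrier N" "s \<in> carrier K" "act L s (l a) = v" for a b s
  proof -
    obtain u q where "u \<in> Units K" "l a = act L u (l b)"
      "q \<in> carrier K" "act L q (l a) = v" "act L q (l b) = v" using h(1) unfolding E_def by blast
    then show ?thesis using unit_cancel[OF LM l l] h(2-5) by blast
  qed
  have E_trans: "E a c" if h: "E a b" "E b c" "a \<in> carrier N" "b \<in> carrier N" "c \<in> carrier N" for a b c
  proof -
    obtain u where u: "u \<in> Units K" "l a = act L u (l b)" using h(1) unfolding E_def by blast
    obtain u' where u': "u' \<in> Units K" "l b = act L u' (l c)" using h(2) unfolding E_def by blast
    have "l a = act L (u \<otimes>\<^bsub>K\<^esub> u') (l c)"
      using u u' l h by (simp add: L.act_mult L.Units_closed)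
    moreover obtain q where "q \<in> carrier K" "act L q (l a) = v" "act L q (l b) = v"
      using h(1) unfolding E_def by blast
    moreover from this have "act L q (l c) = v" using E_cancel[OF h(2,4,5)] by blast
    ultimately show ?thesis using u u' unfolding E_def by blast
  qed
  have E_I: "a \<in> I \<and> b \<in> I" if "E a b" "a \<in> carrier N" "b \<in> carrier N" for a b
    using that unfolding E_def I_def by blast
  have E_refl: "E a a" if h: "a \<in> I" for a
  proof -
    have "l a = act L \<one>\<^bsub>K\<^esub> (l a)" using h l by (simp add: I_def L.act_one)
    then show ?thesis using h unfolding E_def I_def by blast
  qed
  have "equiv (carrier N) (cogen_congruence Q T r P w)"
  proof (rule equivI)
    show "cogen_congruence Q T r P w \<subseteq> carrier N \<times> carrier N"
      using C by auto
    show "refl_on (carrier N) (cogen_congruence Q T r P w)"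
      using C E_refl by (auto simp: refl_on_def)
    show "sym (cogen_congruence Q T r P w)"
      using C E_sym by (meson symI)
    show "trans (cogen_congruence Q T r P w)"
    proof (rule transI)
      fix a b c assume "(a, b) \<in> cogen_congruence Q T r P w" "(b, c) \<in> cogen_congruence Q T r P w"
      then show "(a, c) \<in> cogen_congruence Q T r P w"
        unfolding C using E_trans[of a b c] E_I[of a b] E_I[of b c] by blast
    qed
  qed
  moreover have "(act N q a, act N q b) \<in> cogen_congruence Q T r P w"
    if ab: "(a, b) \<in> cogen_congruence Q T r P w" and q: "q \<in> carrier Q" for a b q
  proof -
    have c: "a \<in> carrier N" "b \<in> carrier N" using ab C by auto
    have cq: "act N q a \<in> carrier N" "act N q b \<in> carrier N" using N.act_closed c q by auto
    have below: "x \<in> I \<and> (\<exists>t \<in> carrier K. act L (t \<otimes>\<^bsub>K\<^esub> i q) (l x) = v \<and> act L t (l (act N q x)) = v)"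
      if x: "act N q x \<in> I" "x \<in> carrier N" for x
    proof -
      obtain t where t: "t \<in> carrier K" "act L t (l (act N q x)) = v" using x I_def by blast
      then have "act L (t \<otimes>\<^bsub>K\<^esub> i q) (l x) = v"
        using x q i l by (simp add: li L.act_mult)
      then show ?thesis using x t q i L.m_closed unfolding I_def by blast
    qed
    have shift: "E (act N q x) (act N q y)"
      if h: "E x y" "x \<in> carrier N" "y \<in> carrier N" "act N q x \<in> I" for x y
    proof -
      obtain t where t: "t \<in> carrier K" "act L (t \<otimes>\<^bsub>K\<^esub> i q) (l x) = v" "act L t (l (act N q x)) = v"
        using below[OF h(4,2)] by blast
      have "act L (t \<otimes>\<^bsub>K\<^esub> i q) (l y) = v"
        using E_cancel[OF h(1-3) L.m_closed[OF t(1) i[OF q]] t(2)] .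
      then have ty: "act L t (l (act N q y)) = v"
        using t(1) h(3) q i l by (simp add: li L.act_mult)
      obtain u where u: "u \<in> Units K" "l x = act L u (l y)" using h(1) unfolding E_def by blast
      have "l (act N q x) = act L (i q \<otimes>\<^bsub>K\<^esub> u) (l y)"
        using h(2,3) q u i l by (simp add: li L.act_mult L.Units_closed)
      also have "i q \<otimes>\<^bsub>K\<^esub> u = u \<otimes>\<^bsub>K\<^esub> i q"
        using q u i by (simp add: L.m_comm L.Units_closed)
      also have "act L (u \<otimes>\<^bsub>K\<^esub> i q) (l y) = act L u (l (act N q y))"
        using h(2,3) q u(1) i l by (simp add: li L.act_mult L.Units_closed)
      finally have "l (act N q x) = act L u (l (act N q y))" .
      then show ?thesis using u t ty unfolding E_def by blast
    qed
    show ?thesis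
    proof (cases "act N q a \<in> I \<or> act N q b \<in> I")
      case True
      then have "a \<in> I \<or> b \<in> I" using below c by blast
      then have "E a b" using ab C by blast
      then have "E (act N q a) (act N q b)"
        using True shift[OF \<open>E a b\<close> c] E_sym[OF shift[OF E_sym[OF \<open>E a b\<close> c] c(2,1)]] cq by blast
      then show ?thesis using C cq by blast
    qed (use C cq in blast)
  qed
  ultimately show ?thesis unfolding module_congruence_def N_def by blast
qed

text \<open>If there are no key witnesses, the common refinement is the universal congruence.\<close>

definition key_refinement ::
  "('q, 'm) monoid_scheme \<Rightarrow> ('q, 't) mset \<Rightarrow> ('t \<times> 't) set \<Rightarrow> ('t set \<times> 't set) set" where
  "key_refinement Q T r =
     (carrier (quot_module T r) \<times> carrier (quot_module T r)) \<inter>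
     (\<Inter>(P, w) \<in> {(P, w). prime_monoid_ideal Q P \<and> key_witness Q T r P w}.
        cogen_congruence Q T r P w)"

end

theory Submission
  imports Defs
begin

text \<open>
  Write \<open>N = T/\<sim>\<close>. Nil elements of \<open>N\<close> stay nil in every localization, and the only element of
  a module below which a nil element can lie in Green's preorder is that element itself. So a nil
  element is outside the order ideal of every non-nil \<open>w\<close>, and all nil elements are identified.

  The converse rests on associated primes. For \<open>a \<noteq> b\<close> in \<open>N\<close> consider the ideals
  \<open>I(q) = {x. x q a = x q b}\<close> of \<open>Q\<close> with \<open>q a \<noteq> q b\<close>. Among them a suitably large one is a prime
  \<open>P\<close>, as for associated primes of modules over a Noetherian ring
  (\<open>pair_associated_prime\<close>). Then \<open>q a\<close> and \<open>q b\<close> stay distinct in \<open>N\<^sub>P\<close>, because no element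
  outside \<open>P\<close> identifies them, while every element of \<open>P\<close> does identify them. So they lie in one
  non-singleton class of \<open>\<Inter>p\<in>P. ker \<phi>\<^sub>p\<close>. A class has at most one exclusively maximal element, and
  a nil element of a class is always maximal in it; hence one of \<open>q a\<close>, \<open>q b\<close> is a key witness
  unless both are nil in \<open>N\<^sub>P\<close> (\<open>distinct_elements_key_witness\<close>).

  A key witness \<open>w = q a\<close> obtained in this way separates \<open>a\<close> from \<open>b\<close>: elements that differ by a
  unit and have one common multiplier to \<open>w\<close> have all multipliers to \<open>w\<close> in common, whereas \<open>q\<close>
  takes \<open>a\<close>, but not \<open>b\<close>, to \<open>w\<close> (\<open>cogen_congruence_reflects\<close>).

  There remains the case that \<open>q a\<close> and \<open>q b\<close> are both nil in \<open>N\<^sub>P\<close>. As \<open>Q\<close> is finitely generated,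
  \<open>a\<close> and \<open>b\<close> then have nil multiples \<open>c \<noteq> d\<close> already in \<open>N\<close> (\<open>nil_loc_descends\<close>). If \<open>a\<close> is not
  nil, the same construction for the pair \<open>a \<noteq> c\<close> cannot end with two nil elements, so it
  gives a key witness which is a multiple of \<open>a\<close>. If the congruence that it cogenerates identified
  \<open>a\<close> and \<open>b\<close>, then \<open>f a = g b\<close> for some \<open>f\<close>, \<open>g\<close>, and \<open>a\<close>, \<open>b\<close> would have a common nil multiple,
  which contradicts \<open>c \<noteq> d\<close> (\<open>key_refinement_pair_nil\<close>). So \<open>a\<close> is nil, and likewise \<open>b\<close>.
\<close>

section \<open>Associated primes of pairs of elements\<close>

text \<open>
  The ideal \<open>P\<close> is an associated prime of the pair: multiplying by \<open>f\<close> outside \<open>I(q)\<close> can only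
  enlarge the ideal \<open>I(q) = {x. x q a = x q b}\<close>, so a maximal one is prime. It is enough to
  maximize the number of elements of a finite generating set in \<open>I(q)\<close>: primality against the
  generators extends to their products. This replaces the ascending chain condition on ideals
  by the maximum of a bounded counting function.
\<close>

lemma (in monoid_module) pair_associated_prime:
  assumes fg: "noetherian_monoid Q" and ab: "a \<in> carrier T" "b \<in> carrier T" "a \<noteq> b"
  obtains q P where "q \<in> carrier Q" "prime_monoid_ideal Q P"
    "P = {x \<in> carrier Q. act T x (act T q a) = act T x (act T q b)}"
proof -
  obtain A where A: "finite A" "A \<subseteq> carrier Q"
    and gen: "\<forall>H. submonoid H Q \<and> A \<subseteq> H \<longrightarrow> H = carrier Q"
    using fg unfolding noetherian_monoid_def by blast
  define I where "I q = {x \<in> carrier Q. act T x (act T q a) = act T x (act T q b)}" for q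
  define D where "D q \<longleftrightarrow> q \<in> carrier Q \<and> act T q a \<noteq> act T q b" for q
  have D1: "D \<one>" using ab by (simp add: D_def act_one)
  have bound: "\<forall>q. D q \<longrightarrow> card (A \<inter> I q) < Suc (card A)"
    using A(1) by (simp add: card_mono less_Suc_eq_le)
  obtain q where q: "D q" and max: "\<forall>q'. D q' \<longrightarrow> card (A \<inter> I q') \<le> card (A \<inter> I q)"
    using ex_has_greatest_nat[OF D1 bound] by (elim exE conjE)
  have qc: "q \<in> carrier Q" using q by (simp add: D_def)
  note c = qc ab(1,2)
  have ideal: "y \<otimes> x \<in> I q" if "x \<in> I q" "y \<in> carrier Q" for x y
    using that c by (simp add: I_def act_mult act_closed)
  have shift: "A \<inter> I (f \<otimes> q) = A \<inter> I q" if f: "f \<in> carrier Q" "f \<notin> I q" for f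
  proof -
    have "D (f \<otimes> q)" using f c by (simp add: D_def I_def act_mult)
    moreover have "I q \<subseteq> I (f \<otimes> q)"
    proof
      fix x assume x: "x \<in> I q"
      then have "x \<in> carrier Q" by (simp add: I_def)
      moreover have "f \<otimes> x \<in> I q" using ideal x f by blast
      ultimately show "x \<in> I (f \<otimes> q)"
        using f c by (simp add: I_def act_mult[symmetric] act_closed m_ac)
    qed
    ultimately have "A \<inter> I q \<subseteq> A \<inter> I (f \<otimes> q)" "card (A \<inter> I (f \<otimes> q)) \<le> card (A \<inter> I q)"
      using max by blast+
    then show ?thesis using card_seteq[OF finite_Int[OF disjI1[OF A(1)]]] by blast
  qed
  \<comment> \<open>The elements \<open>g\<close> for which primality of \<open>I q\<close> holds against every \<open>f\<close>.\<close>
  define H where "H = {g \<in> carrier Q. \<forall>f \<in> carrier Q. f \<otimes> g \<in> I q \<longrightarrow> f \<in> I q \<or> g \<in> I q}"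
  have "submonoid H Q"
  proof
    show "H \<subseteq> carrier Q" by (auto simp: H_def)
    show "\<one> \<in> H" by (simp add: H_def)
    fix g h assume gh: "g \<in> H" "h \<in> H"
    then have gc: "g \<in> carrier Q" "h \<in> carrier Q" by (auto simp: H_def)
    have "f \<in> I q \<or> g \<otimes> h \<in> I q" if f: "f \<in> carrier Q" "f \<otimes> (g \<otimes> h) \<in> I q" for f
    proof -
      have "f \<otimes> g \<in> I q \<or> h \<in> I q"
        using f gh(2) gc m_assoc[of f g h] m_closed[of f g] unfolding H_def by auto
      then have "f \<in> I q \<or> g \<in> I q \<or> h \<in> I q" using f gh by (auto simp: H_def)
      then show ?thesis using f ideal[of g h] ideal[of h g] gc m_comm[of g h] by auto
    qed
    then show "g \<otimes> h \<in> H" using gc by (simp add: H_def)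
  qed
  moreover have "A \<subseteq> H"
  proof
    fix g assume g: "g \<in> A"
    have "g \<in> I q" if f: "f \<in> carrier Q" "f \<otimes> g \<in> I q" "f \<notin> I q" for f
    proof -
      have "g \<in> I (f \<otimes> q)"
        using f g A(2) c by (auto simp: I_def act_mult[symmetric] m_ac)
      then show ?thesis using shift[OF f(1,3)] g by blast
    qed
    then show "g \<in> H" using g A(2) by (auto simp: H_def)
  qed
  ultimately have H: "H = carrier Q" using gen by blast
  have "submonoid (carrier Q - I q) Q"
  proof
    show "\<one> \<in> carrier Q - I q" using q c by (simp add: D_def I_def act_one act_closed)
    show "f \<otimes> g \<in> carrier Q - I q" if "f \<in> carrier Q - I q" "g \<in> carrier Q - I q" for f g
    proof -
      have "g \<in> H" using that H by blast
      then show ?thesis using that by (auto simp: H_def)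
    qed
  qed blast
  moreover have "monoid_ideal Q (I q)"
    using ideal by (auto simp: monoid_ideal_def I_def)
  ultimately have "prime_monoid_ideal Q (I q)" by (simp add: prime_monoid_ideal_def)
  then show thesis using that[OF qc _ I_def] by blast
qed

section \<open>Nil elements and localization\<close>

lemma nil_iff:
  assumes "monoid_module Q T"
  shows "nil Q T x \<longleftrightarrow> x \<in> carrier T \<and> (\<forall>q \<in> carrier Q. act T q x = x)"
proof -
  interpret monoid_module Q T by fact
  have "x \<in> orbit_of Q T x" if "x \<in> carrier T"
    unfolding orbit_of_def using act_one[OF that] one_closed by force
  then show ?thesis unfolding nil_def by (auto simp: orbit_of_def)
qed

context localized_module
begin

abbreviation "QP \<equiv> loc_monoid Q P"
abbreviation "TP \<equiv> loc_module Q P T"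
abbreviation "loc \<equiv> loc_map Q P T"

lemma monoid_module_TP: "monoid_module QP TP"
  by (rule monoid_module_loc_module[OF localized_module_axioms])

lemma loc_closed: "t \<in> carrier T \<Longrightarrow> loc t \<in> carrier TP"
  unfolding loc_map_def by (rule frac_in_loc_module[OF _ denom(2)])

lemma loc_eq_iff:
  assumes "t \<in> carrier T" "t' \<in> carrier T"
  shows "loc t = loc t' \<longleftrightarrow> (\<exists>f \<in> carrier Q - P. act T f t = act T f t')"
  unfolding loc_map_def using frac_eq_iff[OF assms denom(2,2)] by simp

lemma carrier_QPE:
  assumes "x \<in> carrier QP"
  obtains q f where "q \<in> carrier Q" "f \<in> carrier Q - P" "x = frac Q P (regular_module Q) q f"
proof -
  interpret R: localized_module Q "regular_module Q" P
    by (rule regular_localized_module[OF comm_monoid_axioms prime])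
  show ?thesis
    using assms that unfolding loc_monoid_regular
    by (elim R.carrier_loc_moduleE) (simp add: regular_module_def)
qed

lemma loc_map_regular_closed:
  assumes "q \<in> carrier Q"
  shows "loc_map Q P (regular_module Q) q \<in> carrier QP"
proof -
  interpret R: localized_module Q "regular_module Q" P
    by (rule regular_localized_module[OF comm_monoid_axioms prime])
  show ?thesis unfolding loc_monoid_regular
    using assms by (intro R.loc_closed) (simp add: regular_module_def)
qed

lemma act_loc:
  assumes "q \<in> carrier Q" "t \<in> carrier T"
  shows "act TP (loc_map Q P (regular_module Q) q) (loc t) = loc (act T q t)"
  unfolding loc_map_def using loc_act_frac[OF localized_module_axioms] assms denom(2) by simp

lemma nil_loc_act:
  assumes "nil QP TP (loc t)" "t \<in> carrier T" "q \<in> carrier Q"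
  shows "loc (act T q t) = loc t"
  using assms act_loc[OF assms(3,2)] loc_map_regular_closed
  by (simp add: nil_iff[OF monoid_module_TP])

lemma nil_loc:
  assumes "nil Q T t"
  shows "nil QP TP (loc t)"
proof -
  have t: "t \<in> carrier T" "\<And>q. q \<in> carrier Q \<Longrightarrow> act T q t = t"
    using assms by (simp_all add: nil_iff[OF monoid_module_axioms])
  have "act TP x (loc t) = loc t" if xQ: "x \<in> carrier QP" for x
  proof -
    obtain q f where x: "q \<in> carrier Q" "f \<in> carrier Q - P" "x = frac Q P (regular_module Q) q f"
      using carrier_QPE[OF xQ] by blast
    have "act TP x (loc t) = frac Q P T t f"
      unfolding loc_map_def x(3) using loc_act_frac[OF localized_module_axioms x(1,2) t(1) denom(2)] x t
      by simp
    also have "\<dots> = loc t"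
      unfolding loc_map_def using frac_eq_iff[OF t(1,1) x(2) denom(2)] denom(2) x t by auto
    finally show ?thesis .
  qed
  then show ?thesis using loc_closed t by (simp add: nil_iff[OF monoid_module_TP])
qed

text \<open>
  Nilness in the localization says that each \<open>x\<close> fixes \<open>t\<close> after multiplication by some denominator
  depending on \<open>x\<close>. The product of the denominators for the finitely many generators serves for
  all generators at once, hence for all of \<open>Q\<close>.
\<close>

lemma nil_loc_descends:
  assumes fg: "noetherian_monoid Q" and t: "t \<in> carrier T" and nil: "nil QP TP (loc t)"
  obtains f where "f \<in> carrier Q - P" "nil Q T (act T f t)"
proof -
  obtain A where A: "finite A" "A \<subseteq> carrier Q"
    and gen: "\<forall>H. submonoid H Q \<and> A \<subseteq> H \<longrightarrow> H = carrier Q"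
    using fg unfolding noetherian_monoid_def by blast
  have "\<exists>f \<in> carrier Q - P. \<forall>x \<in> B. act T f (act T x t) = act T f t"
    if "finite B" "B \<subseteq> carrier Q" for B
    using that
  proof (induction B rule: finite_induct)
    case empty
    show ?case using denom(2) by blast
  next
    case (insert y B)
    then obtain f where f: "f \<in> carrier Q - P" "\<And>x. x \<in> B \<Longrightarrow> act T f (act T x t) = act T f t"
      by auto
    obtain g where g: "g \<in> carrier Q - P" "act T g (act T y t) = act T g t"
      using nil_loc_act[OF nil t, of y] loc_eq_iff[OF act_closed[OF _ t] t, of y] insert.prems by auto
    have "act T (f \<otimes> g) (act T x t) = act T (f \<otimes> g) t" if x: "x \<in> insert y B" for x
    proof (cases "x = y")
      case True
      then show ?thesis using f(1) g t insert.prems by (simp add: act_mult act_closed)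
    next
      case False
      then have "act T g (act T f (act T x t)) = act T g (act T f t)" using x f(2) by simp
      moreover have "x \<in> carrier Q" using x insert.prems by blast
      moreover have "f \<otimes> g = g \<otimes> f" using f(1) g(1) by (simp add: m_comm)
      ultimately show ?thesis using f(1) g(1) t by (simp add: act_mult act_closed)
    qed
    then show ?case using denom(1)[OF f(1) g(1)] by blast
  qed
  from this[OF A] obtain f where f: "f \<in> carrier Q - P"
    "\<And>x. x \<in> A \<Longrightarrow> act T f (act T x t) = act T f t" by blast
  define H where "H = {x \<in> carrier Q. act T x (act T f t) = act T f t}"
  have ft: "act T f t \<in> carrier T" using f(1) t by (simp add: act_closed)
  have "submonoid H Q"
    by unfold_locales (auto simp: H_def ft act_one act_mult)
  moreover have "A \<subseteq> H"
  proof
    fix x assume x: "x \<in> A"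
    have "act T x (act T f t) = act T f (act T x t)"
      using x A(2) f(1) t by (auto simp: act_mult[symmetric] m_comm)
    then show "x \<in> H" using x A(2) f(2) by (auto simp: H_def)
  qed
  ultimately have "H = carrier Q" using gen by blast
  then have "nil Q T (act T f t)"
    using ft by (auto simp: nil_iff[OF monoid_module_axioms] H_def)
  then show thesis using that f(1) by blast
qed

section \<open>Existence and use of key witnesses\<close>

lemma prime_kernel_locI:
  assumes t: "t \<in> carrier T" "t' \<in> carrier T"
    and p: "\<And>p. p \<in> P \<Longrightarrow> act T p t = act T p t'"
  shows "(loc t, loc t') \<in> prime_kernel Q P T"
proof -
  have "P \<subseteq> carrier Q" using prime by (simp add: prime_monoid_ideal_def monoid_ideal_def)
  then show ?thesis
    using t p loc_closed act_loc
    by (auto simp: prime_kernel_def kernel_of_def action_map_def subset_iff)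
qed

end

lemma nil_maximal:
  assumes M: "monoid_module Q T" and x: "nil Q T x" "x \<in> A" and A: "A \<subseteq> carrier T"
  shows "x \<in> maximal_elements Q T A"
proof -
  interpret monoid_module Q T by fact
  have "y = x" if y: "y \<in> A" "green_le Q T x y" for y
  proof -
    have "x \<in> carrier T" "y \<in> carrier T" using x A y by blast+
    then obtain q where "q \<in> carrier Q" "act T q x = y"
      using y(2) green_le_iff[OF M] by blast
    then show "y = x" using x(1) by (simp add: nil_iff[OF M])
  qed
  then show ?thesis using x(2) by (auto simp: maximal_elements_def)
qed

text \<open>
  Two reasons keep an element from being exclusively maximal: if one of the two elements is
  nil, it is a further maximal element of the class beside the other one; if neither is nil, they
  cannot both be the unique maximal element.
\<close>

lemma key_witness_of_pair:
  fixes Q (structure)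
  assumes M: "monoid_module Q T" and r: "module_congruence Q T r"
    and P: "prime_monoid_ideal Q P" and c: "x \<in> carrier T" "y \<in> carrier T"
    and ker: "(bar Q T r P x, bar Q T r P y) \<in> prime_kernel Q P (quot_module T r)"
    and ne: "bar Q T r P x \<noteq> bar Q T r P y"
    and nn: "\<not> (nil (loc_monoid Q P) (loc_module Q P (quot_module T r)) (bar Q T r P x)
      \<and> nil (loc_monoid Q P) (loc_module Q P (quot_module T r)) (bar Q T r P y))"
  shows "key_witness Q T r P x \<or> key_witness Q T r P y"
proof -
  define N where "N = quot_module T r"
  define K where "K = loc_monoid Q P"
  define L where "L = loc_module Q P N"
  define C where "C = prime_kernel Q P N `` {bar Q T r P x}"
  have "localized_module Q N P"
    using monoid_module_quot_module[OF M r] P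
    by (simp add: N_def localized_module_def localized_module_axioms_def)
  then have LM: "monoid_module K L"
    unfolding K_def L_def by (rule monoid_module_loc_module)
  have CL: "C \<subseteq> carrier L" by (auto simp: C_def L_def prime_kernel_def)
  have C': "prime_kernel Q P N `` {bar Q T r P y} = C"
    using ker unfolding C_def N_def by (auto simp: prime_kernel_def kernel_of_def)
  have xy: "bar Q T r P x \<in> C" "bar Q T r P y \<in> C"
    using ker unfolding C_def N_def by (auto simp: prime_kernel_def kernel_of_def)
  then have "\<not> is_singleton C" using ne by (auto simp: is_singleton_def)
  then have key: "\<not> nil K L (bar Q T r P x) \<Longrightarrow>
      \<not> exclusively_maximal K L C (bar Q T r P x) \<Longrightarrow> key_witness Q T r P x"
    and key': "\<not> nil K L (bar Q T r P y) \<Longrightarrow>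
      \<not> exclusively_maximal K L C (bar Q T r P y) \<Longrightarrow> key_witness Q T r P y"
    using c C'
    by (simp_all add: key_witness_def C_def N_def[symmetric] K_def[symmetric] L_def[symmetric])
  have excl: "nil K L z \<Longrightarrow> z \<in> C \<Longrightarrow> exclusively_maximal K L C v \<Longrightarrow> v = z" for z v
    using nil_maximal[OF LM _ _ CL] by (auto simp: exclusively_maximal_def)
  have "\<not> (exclusively_maximal K L C (bar Q T r P x) \<and> exclusively_maximal K L C (bar Q T r P y))"
    using ne by (auto simp: exclusively_maximal_def)
  moreover have "\<not> (nil K L (bar Q T r P x) \<and> nil K L (bar Q T r P y))"
    using nn by (simp add: K_def L_def N_def)
  ultimately show ?thesis using key key' excl xy ne by metis
qed

text \<open>
  The associated prime of \<open>a\<close> and \<open>b\<close> is the place at which to look for witnesses: outside \<open>P\<close>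
  nothing identifies \<open>q a\<close> with \<open>q b\<close>, so they survive localization as distinct elements, and
  all of \<open>P\<close> identifies them, so they share a class of the kernel.
\<close>

lemma distinct_elements_key_witness:
  fixes Q (structure)
  assumes fg: "noetherian_monoid Q"
    and M: "monoid_module Q T" and r: "module_congruence Q T r"
    and ab: "a \<in> carrier (quot_module T r)" "b \<in> carrier (quot_module T r)" "a \<noteq> b"
  obtains q P x y where "q \<in> carrier Q" "prime_monoid_ideal Q P"
    "x \<in> carrier T" "y \<in> carrier T"
    "bar Q T r P x = loc_map Q P (quot_module T r) (act (quot_module T r) q a)"
    "bar Q T r P y = loc_map Q P (quot_module T r) (act (quot_module T r) q b)"
    "bar Q T r P x \<noteq> bar Q T r P y"
    "key_witness Q T r P x \<or> key_witness Q T r P y \<or>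
      nil (loc_monoid Q P) (loc_module Q P (quot_module T r)) (bar Q T r P x) \<and>
      nil (loc_monoid Q P) (loc_module Q P (quot_module T r)) (bar Q T r P y)"
proof -
  define N where "N = quot_module T r"
  have NM: "monoid_module Q N" unfolding N_def by (rule monoid_module_quot_module[OF M r])
  interpret N0: monoid_module Q N by (rule NM)
  have N: "a \<in> carrier N" "b \<in> carrier N" using ab by (simp_all add: N_def)
  obtain q P where q: "q \<in> carrier Q" and P: "prime_monoid_ideal Q P"
    and Pq: "P = {x \<in> carrier Q. act N x (act N q a) = act N x (act N q b)}"
    by (rule N0.pair_associated_prime[OF fg N ab(3)])
  interpret N: localized_module Q N P
    using NM P by (simp add: localized_module_def localized_module_axioms_def)
  have qN: "act N q a \<in> carrier N" "act N q b \<in> carrier N" using q N by (simp_all add: N0.act_closed)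
  have ne: "N.loc (act N q a) \<noteq> N.loc (act N q b)"
    using N.loc_eq_iff[OF qN] Pq by blast
  have ker: "(N.loc (act N q a), N.loc (act N q b)) \<in> prime_kernel Q P N"
    by (rule N.prime_kernel_locI[OF qN]) (use Pq in blast)
  obtain x where x: "x \<in> carrier T" "act N q a = r `` {x}"
    using qN by (auto simp: N_def quot_module_def elim: quotientE)
  obtain y where y: "y \<in> carrier T" "act N q b = r `` {y}"
    using qN by (auto simp: N_def quot_module_def elim: quotientE)
  have bar: "bar Q T r P x = N.loc (act N q a)" "bar Q T r P y = N.loc (act N q b)"
    using x y by (simp_all add: bar_def N_def)
  show thesis
    using that[OF q P x(1) y(1) bar[unfolded N_def] ne[folded bar]]
      key_witness_of_pair[OF M r P x(1) y(1) ker[folded bar, unfolded N_def] ne[folded bar]]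
    by blast
qed

text \<open>
  Since \<open>a\<close> divides \<open>w\<close> in the localization, identification of \<open>a\<close> with \<open>b\<close> must come from a unit
  \<open>u\<close> with \<open>a = u b\<close>. The first conclusion (with \<open>unit_cancel\<close>) shows that a witness \<open>q a\<close>
  different from \<open>q b\<close> separates \<open>a\<close> from \<open>b\<close>. The second clears the denominators of
  \<open>a = u b\<close> and is what survives when \<open>w\<close> was not chosen with regard to \<open>b\<close>.
\<close>

lemma cogen_congruence_reflects:
  fixes Q (structure)
  assumes M: "monoid_module Q T" and r: "module_congruence Q T r"
    and P: "prime_monoid_ideal Q P" and w: "w \<in> carrier T" and q: "q \<in> carrier Q"
    and ab: "(a, b) \<in> cogen_congruence Q T r P w"
    and wq: "bar Q T r P w = loc_map Q P (quot_module T r) (act (quot_module T r) q a)"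
  shows "loc_map Q P (quot_module T r) (act (quot_module T r) q a)
      = loc_map Q P (quot_module T r) (act (quot_module T r) q b)"
    and "\<exists>f \<in> carrier Q. \<exists>g \<in> carrier Q.
      act (quot_module T r) f a = act (quot_module T r) g b"
proof -
  define N where "N = quot_module T r"
  define K where "K = loc_monoid Q P"
  define L where "L = loc_module Q P N"
  define i where "i = loc_map Q P (regular_module Q)"
  interpret N: localized_module Q N P
    using monoid_module_quot_module[OF M r] P
    by (simp add: N_def localized_module_def localized_module_axioms_def)
  have LM: "monoid_module K L"
    unfolding K_def L_def by (rule N.monoid_module_TP)
  interpret L: monoid_module K L by (rule LM)
  have c: "a \<in> carrier N" "b \<in> carrier N"
    using ab by (auto simp: cogen_congruence_def N_def)
  have l: "N.loc a \<in> carrier L" "N.loc b \<in> carrier L"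
    using c N.loc_closed by (simp_all add: L_def)
  have i: "i q \<in> carrier K" unfolding i_def K_def by (rule N.loc_map_regular_closed[OF q])
  have ia: "act L (i q) (N.loc a) = bar Q T r P w"
    using N.act_loc[OF q c(1)] wq by (simp add: L_def i_def N_def)
  have "bar Q T r P w \<in> carrier L" using ia L.act_closed[OF i l(1)] by simp
  then have "green_le K L (N.loc a) (bar Q T r P w)"
    using green_le_iff[OF LM l(1)] i ia by blast
  then have "a \<in> cogen_order_ideal Q T r P w"
    using c by (simp add: cogen_order_ideal_def N_def K_def L_def)
  then obtain u s where u: "u \<in> Units K" "N.loc a = act L u (N.loc b)"
    and s: "s \<in> carrier K" "act L s (N.loc a) = bar Q T r P w" "act L s (N.loc b) = bar Q T r P w"
    using ab unfolding cogen_congruence_def N_def K_def L_def by blast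
  have "act L (i q) (N.loc b) = bar Q T r P w"
    by (rule unit_cancel[OF LM l u(1) s(1) i u(2) s(2,3) ia])
  then show "loc_map Q P (quot_module T r) (act (quot_module T r) q a)
      = loc_map Q P (quot_module T r) (act (quot_module T r) q b)"
    using N.act_loc[OF q c(2)] wq by (simp add: L_def i_def N_def)
  have "u \<in> carrier (loc_monoid Q P)" using u(1) L.Units_closed by (simp add: K_def)
  then obtain t h where t: "t \<in> carrier Q" "h \<in> carrier Q - P"
    "u = frac Q P (regular_module Q) t h"
    using N.carrier_QPE by blast
  have "frac Q P N a \<one> = frac Q P N (act N t b) h"
    using u(2) loc_act_frac[OF N.localized_module_axioms t(1,2) c(2) N.denom(2)] t
    by (simp add: loc_map_def L_def)
  then obtain v where v: "v \<in> carrier Q - P" "act N (v \<otimes> h) a = act N (v \<otimes> \<one>) (act N t b)"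
    using N.frac_eq_iff[OF c(1) N.act_closed[OF t(1) c(2)] N.denom(2) t(2)] by blast
  then have "act N (v \<otimes> h) a = act N (v \<otimes> t) b"
    using t c by (simp add: N.act_mult N.act_closed)
  then show "\<exists>f \<in> carrier Q. \<exists>g \<in> carrier Q.
      act (quot_module T r) f a = act (quot_module T r) g b"
    using v(1) t by (metis DiffD1 N.m_closed N_def)
qed

section \<open>The common refinement\<close>

text \<open>
  A non-nil \<open>a\<close> with a nil multiple \<open>c = s a\<close> yields a key witness \<open>q a\<close> from the pair \<open>a \<noteq> c\<close>:
  if \<open>q a\<close> were nil in the localization, then it would equal its multiple \<open>s q a = q c = c\<close>.
  If it did not separate \<open>a\<close> from \<open>b\<close>, then \<open>a\<close> and \<open>b\<close> would have a common multiple, hence the same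
  nil multiple, because a module element has at most one.
\<close>

lemma key_refinement_pair_nil:
  fixes Q (structure)
  assumes fg: "noetherian_monoid Q"
    and M: "monoid_module Q T" and r: "module_congruence Q T r"
    and ab: "(a, b) \<in> key_refinement Q T r"
    and s: "s \<in> carrier Q" "nil Q (quot_module T r) (act (quot_module T r) s a)"
    and t: "t \<in> carrier Q" "nil Q (quot_module T r) (act (quot_module T r) t b)"
    and ne: "act (quot_module T r) s a \<noteq> act (quot_module T r) t b"
  shows "nil Q (quot_module T r) a"
proof (rule ccontr)
  define N where "N = quot_module T r"
  have NM: "monoid_module Q N" unfolding N_def by (rule monoid_module_quot_module[OF M r])
  interpret N0: monoid_module Q N by (rule NM)
  define c where "c = act N s a"
  define d where "d = act N t b"
  have nc: "nil Q N c" "nil Q N d" "c \<noteq> d" using s t ne by (simp_all add: c_def d_def N_def)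
  then have cN: "c \<in> carrier N" and cfix: "\<And>q. q \<in> carrier Q \<Longrightarrow> act N q c = c"
    and dfix: "\<And>q. q \<in> carrier Q \<Longrightarrow> act N q d = d"
    by (simp_all add: nil_iff[OF NM])
  have N: "a \<in> carrier N" "b \<in> carrier N" using ab by (auto simp: key_refinement_def N_def)
  assume "\<not> nil Q (quot_module T r) a"
  then have "a \<noteq> c" using nc by (auto simp: N_def)
  obtain q P x y where q: "q \<in> carrier Q" and P: "prime_monoid_ideal Q P"
    and xy: "x \<in> carrier T" "y \<in> carrier T"
    and bar: "bar Q T r P x = loc_map Q P N (act N q a)" "bar Q T r P y = loc_map Q P N (act N q c)"
    and ne': "bar Q T r P x \<noteq> bar Q T r P y"
    and key: "key_witness Q T r P x \<or> key_witness Q T r P y \<or>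
      nil (loc_monoid Q P) (loc_module Q P N) (bar Q T r P x) \<and>
      nil (loc_monoid Q P) (loc_module Q P N) (bar Q T r P y)"
    by (rule distinct_elements_key_witness[OF fg M r N(1)[unfolded N_def] cN[unfolded N_def] \<open>a \<noteq> c\<close>,
          folded N_def])
  interpret N: localized_module Q N P
    using NM P by (simp add: localized_module_def localized_module_axioms_def)
  have qa: "act N q a \<in> carrier N" using q N by (simp add: N0.act_closed)
  have sqa: "act N s (act N q a) = c"
  proof -
    have "act N s (act N q a) = act N q c"
      using s q N by (simp add: c_def N0.act_mult[symmetric] N0.m_comm)
    then show ?thesis using cfix q by simp
  qed
  have "\<not> nil N.QP N.TP (bar Q T r P x)"
    using N.nil_loc_act[OF _ qa s(1)] ne' sqa unfolding bar cfix[OF q] by auto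
  moreover have "\<not> key_witness Q T r P y"
    using N.nil_loc[OF nc(1)] bar(2) cfix[OF q] by (simp add: key_witness_def N_def)
  ultimately have "key_witness Q T r P x" using key by blast
  then have "(a, b) \<in> cogen_congruence Q T r P x"
    using ab P by (auto simp: key_refinement_def)
  then obtain f g where fg: "f \<in> carrier Q" "g \<in> carrier Q" "act N f a = act N g b"
    using cogen_congruence_reflects(2)[OF M r P xy(1) q _ bar(1)[unfolded N_def]]
    unfolding N_def by blast
  \<comment> \<open>From \<open>f a = g b\<close>, the element \<open>t f s a = s g t b\<close> is a multiple of both nil elements.\<close>
  have "c = act N t (act N f c)" using cfix fg t by simp
  also have "\<dots> = act N s (act N t (act N f a))"
    using fg(1) s(1) t(1) N by (simp add: c_def N0.act_mult[symmetric] N0.m_ac)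
  also have "\<dots> = act N s (act N t (act N g b))" by (simp only: fg(3))
  also have "\<dots> = act N (s \<otimes> g) d"
    using fg(2) s(1) t(1) N by (simp add: d_def N0.act_mult[symmetric] N0.m_ac)
  also have "\<dots> = d" using dfix fg s by simp
  finally show False using nc by simp
qed

lemma nil_not_in_cogen_order_ideal:
  fixes Q (structure)
  assumes M: "monoid_module Q T" and r: "module_congruence Q T r"
    and P: "prime_monoid_ideal Q P" and w: "key_witness Q T r P w"
    and z: "nil Q (quot_module T r) z"
  shows "z \<notin> cogen_order_ideal Q T r P w"
proof
  define N where "N = quot_module T r"
  have NM: "monoid_module Q N" unfolding N_def by (rule monoid_module_quot_module[OF M r])
  interpret N: localized_module Q N P
    using NM P by (simp add: localized_module_def localized_module_axioms_def)
  interpret LM: monoid_module N.QP N.TP by (rule N.monoid_module_TP)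
  have nz: "nil N.QP N.TP (N.loc z)" using N.nil_loc z by (simp add: N_def)
  have wc: "bar Q T r P w \<in> carrier N.TP"
    using w unfolding bar_def N_def[symmetric]
    by (intro N.loc_closed) (auto simp: key_witness_def N_def quot_module_def quotientI)
  assume "z \<in> cogen_order_ideal Q T r P w"
  then have "orbit_of N.QP N.TP (bar Q T r P w) \<subseteq> orbit_of N.QP N.TP (N.loc z)"
    by (simp add: cogen_order_ideal_def green_le_def N_def)
  moreover have "bar Q T r P w \<in> orbit_of N.QP N.TP (bar Q T r P w)"
    unfolding orbit_of_def using LM.act_one[OF wc] LM.one_closed by force
  ultimately have "bar Q T r P w = N.loc z" using nz by (auto simp: nil_def)
  then have "nil N.QP N.TP (bar Q T r P w)" using nz by simp
  then show False using w by (simp add: key_witness_def N_def)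
qed

lemma key_refinement_nil:
  fixes Q (structure)
  assumes fg: "noetherian_monoid Q"
    and M: "monoid_module Q T" and r: "module_congruence Q T r"
    and ab: "(a, b) \<in> key_refinement Q T r" and ne: "a \<noteq> b"
  shows "nil Q (quot_module T r) a \<and> nil Q (quot_module T r) b"
proof -
  define N where "N = quot_module T r"
  have NM: "monoid_module Q N" unfolding N_def by (rule monoid_module_quot_module[OF M r])
  interpret N0: monoid_module Q N by (rule NM)
  have N: "a \<in> carrier N" "b \<in> carrier N" using ab by (auto simp: key_refinement_def N_def)
  have sym: "(b, a) \<in> cogen_congruence Q T r P w"
    if c: "(a, b) \<in> cogen_congruence Q T r P w" "prime_monoid_ideal Q P" "key_witness Q T r P w" for P w
  proof -
    have "w \<in> carrier T" using c(3) by (simp add: key_witness_def)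
    from module_congruence_cogen_congruence[OF M r c(2) this]
    have "sym (cogen_congruence Q T r P w)" by (simp add: module_congruence_def equiv_def)
    then show ?thesis using c(1) by (rule symD)
  qed
  have cogen: "(a, b) \<in> cogen_congruence Q T r P w" "(b, a) \<in> cogen_congruence Q T r P w"
    if "prime_monoid_ideal Q P" "key_witness Q T r P w" for P w
    using ab that sym by (auto simp: key_refinement_def)
  obtain q P x y where q: "q \<in> carrier Q" and P: "prime_monoid_ideal Q P"
    and xy: "x \<in> carrier T" "y \<in> carrier T"
    and bar: "bar Q T r P x = loc_map Q P N (act N q a)" "bar Q T r P y = loc_map Q P N (act N q b)"
    and ne': "bar Q T r P x \<noteq> bar Q T r P y"
    and key: "key_witness Q T r P x \<or> key_witness Q T r P y \<or>
      nil (loc_monoid Q P) (loc_module Q P N) (bar Q T r P x) \<and>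
      nil (loc_monoid Q P) (loc_module Q P N) (bar Q T r P y)"
    by (rule distinct_elements_key_witness[OF fg M r N[unfolded N_def] ne, folded N_def])
  interpret N: localized_module Q N P
    using NM P by (simp add: localized_module_def localized_module_axioms_def)
  have qN: "act N q a \<in> carrier N" "act N q b \<in> carrier N" using q N by (simp_all add: N0.act_closed)
  have "\<not> key_witness Q T r P x"
    using cogen_congruence_reflects(1)[OF M r P xy(1) q cogen(1)[OF P] bar(1)[unfolded N_def]]
      ne'[unfolded bar] unfolding N_def by blast
  moreover have "\<not> key_witness Q T r P y"
    using cogen_congruence_reflects(1)[OF M r P xy(2) q cogen(2)[OF P] bar(2)[unfolded N_def]]
      ne'[unfolded bar, symmetric] unfolding N_def by blast
  ultimately have nil: "nil N.QP N.TP (N.loc (act N q a))" "nil N.QP N.TP (N.loc (act N q b))"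
    using key unfolding bar by blast+
  obtain f where f: "f \<in> carrier Q - P" "nil Q N (act N f (act N q a))"
    by (rule N.nil_loc_descends[OF fg qN(1) nil(1)])
  obtain g where g: "g \<in> carrier Q - P" "nil Q N (act N g (act N q b))"
    by (rule N.nil_loc_descends[OF fg qN(2) nil(2)])
  \<comment> \<open>The nil multiples of \<open>a\<close> and \<open>b\<close> differ, as their images are those of \<open>q a\<close> and \<open>q b\<close>.\<close>
  have fgq: "f \<otimes> q \<in> carrier Q" "g \<otimes> q \<in> carrier Q" using f g q by auto
  have eq: "act N (f \<otimes> q) a = act N f (act N q a)"
    "act N (g \<otimes> q) b = act N g (act N q b)"
    using f g q N by (simp_all add: N0.act_mult)
  have ne'': "act N (f \<otimes> q) a \<noteq> act N (g \<otimes> q) b"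
    using N.nil_loc_act[OF nil(1) qN(1), of f] N.nil_loc_act[OF nil(2) qN(2), of g] f(1) g(1)
      ne'[unfolded bar] unfolding eq by auto
  have nils: "nil Q N (act N (f \<otimes> q) a)" "nil Q N (act N (g \<otimes> q) b)"
    using f(2) g(2) by (simp_all only: eq)
  have ba: "(b, a) \<in> key_refinement Q T r"
    using cogen(2) N by (auto simp: key_refinement_def N_def)
  show ?thesis
    using key_refinement_pair_nil[OF fg M r ab fgq(1) nils(1)[unfolded N_def]
        fgq(2) nils(2)[unfolded N_def] ne''[unfolded N_def]]
      key_refinement_pair_nil[OF fg M r ba fgq(2) nils(2)[unfolded N_def]
        fgq(1) nils(1)[unfolded N_def] ne''[unfolded N_def, symmetric]]
    by simp
qed

theorem theorem4p5:
  fixes Q :: "('q, 'm) monoid_scheme" and T :: "('q, 't) mset"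
    and r :: "('t \<times> 't) set"
  assumes "comm_monoid Q" and "noetherian_monoid Q"
    and "monoid_module Q T" and "module_congruence Q T r"
  shows "\<forall>a \<in> carrier (quot_module T r). \<forall>b \<in> carrier (quot_module T r). a \<noteq> b \<longrightarrow>
    ((a, b) \<in> key_refinement Q T r \<longleftrightarrow>
      nil Q (quot_module T r) a \<and> nil Q (quot_module T r) b)"
proof (intro ballI impI iffI)
  note M = assms(3) and r = assms(4)
  fix a b assume N: "a \<in> carrier (quot_module T r)" "b \<in> carrier (quot_module T r)" and ne: "a \<noteq> b"
  show "(a, b) \<in> key_refinement Q T r"
    if nil: "nil Q (quot_module T r) a \<and> nil Q (quot_module T r) b"
  proof -
    have "(a, b) \<in> cogen_congruence Q T r P w"
      if P: "prime_monoid_ideal Q P" and w: "key_witness Q T r P w" for P w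
    proof -
      have "a \<notin> cogen_order_ideal Q T r P w" "b \<notin> cogen_order_ideal Q T r P w"
        using nil nil_not_in_cogen_order_ideal[OF M r P w] by simp_all
      then show ?thesis using N by (simp add: cogen_congruence_def)
    qed
    then show ?thesis using N by (simp add: key_refinement_def split_beta)
  qed
  show "nil Q (quot_module T r) a \<and> nil Q (quot_module T r) b"
    if "(a, b) \<in> key_refinement Q T r"
    by (rule key_refinement_nil[OF assms(2) M r that ne])
qed

end
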